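(* Let $X$ be a finite discrete space with at least two elements, $\Gamma$ a nonempty countable set, and $\varphi:\Gamma\to\Gamma$ a map. Let $\sigma_\varphi:X^\Gamma\to X^\Gamma$ be the generalized shift $\sigma_\varphi((x_\alpha)_{\alpha\in\Gamma})=(x_{\varphi(\alpha)})_{\alpha\in\Gamma}$. The following statements are equivalent: 1. for some $\varepsilon>0$, the system $(X^\Gamma,\sigma_\varphi)$ is densely $\varepsilon$-chaotic; 2. the system $(X^\Gamma,\sigma_\varphi)$ is densely chaotic; 3. the map $\varphi:\Gamma\to\Gamma$ does not have any periodic point (i.e., $W(\varphi)=\Gamma$).
   Context: $X^\Gamma$ carries the product topology. Write $\Gamma=\{\beta_1,\beta_2,\ldots\}$ for a fixed enumeration of $\Gamma$ (a finite list if $\Gamma$ is finite) and equip $X^\Gamma$ with the compatible metric $D((x_\alpha)_{\alpha\in\Gamma},(y_\alpha)_{\alpha\in\Gamma})=\sum_{n\ge1}\delta(x_{\beta_n},y_{\beta_n})/2^n$ (sum over the indices of the enumeration), where $\delta(a,b)=0$ if $a=b$ and $\delta(a,b)=1$ if $a\ne b$. A point $a\in\Gamma$ is a periodic point of $\varphi$ if $\varphi^n(a)=a$ for some $n\ge1$, and a quasi-periodic point of $\varphi$ if there are $n>m\ge1$ with $\varphi^n(a)=\varphi^m(a)$. $W(\varphi)$ is the set of non-quasi-periodic points of $\varphi$. For a continuous self-map $f:Z\to Z$ of a compact metric space $(Z,d)$, a pair $(x,y)\in Z\times Z$ is a scrambled pair if $\liminf_{n\to\infty}d(f^n(x),f^n(y))=0$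 and $\limsup_{n\to\infty}d(f^n(x),f^n(y))>0$. $S(Z,f)$ is the set of all scrambled pairs and, for $\varepsilon>0$, $S_\varepsilon(Z,f)=\{(x,y)\in S(Z,f):\limsup_{n\to\infty}d(f^n(x),f^n(y))>\varepsilon\}$. The system $(Z,f)$ is densely chaotic if $S(Z,f)$ is dense in $Z\times Z$, and densely $\varepsilon$-chaotic if $S_\varepsilon(Z,f)$ is dense in $Z\times Z$. *)

theory Defs
  imports "HOL-Analysis.Analysis"
begin

section \<open>Scrambled pairs and dense chaos\<close>

text \<open>
  A system is given by a carrier \<open>Z\<close>, a metric \<open>d\<close> on \<open>Z\<close> and a self-map \<open>f\<close> of \<open>Z\<close>. The lower and
  upper limits are taken in the extended reals, so that they always exist.
\<close>

definition scrambled_pairs ::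
  "'z set \<Rightarrow> ('z \<Rightarrow> 'z \<Rightarrow> real) \<Rightarrow> ('z \<Rightarrow> 'z) \<Rightarrow> ('z \<times> 'z) set" where
  "scrambled_pairs Z d f = {(x, y) \<in> Z \<times> Z.
     liminf (\<lambda>n. ereal (d ((f ^^ n) x) ((f ^^ n) y))) = 0 \<and>
     limsup (\<lambda>n. ereal (d ((f ^^ n) x) ((f ^^ n) y))) > 0}"

definition eps_scrambled_pairs ::
  "real \<Rightarrow> 'z set \<Rightarrow> ('z \<Rightarrow> 'z \<Rightarrow> real) \<Rightarrow> ('z \<Rightarrow> 'z) \<Rightarrow> ('z \<times> 'z) set" where
  "eps_scrambled_pairs \<epsilon> Z d f = {(x, y) \<in> scrambled_pairs Z d f.
     limsup (\<lambda>n. ereal (d ((f ^^ n) x) ((f ^^ n) y))) > ereal \<epsilon>}"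

definition dense_in_square :: "'z set \<Rightarrow> ('z \<Rightarrow> 'z \<Rightarrow> real) \<Rightarrow> ('z \<times> 'z) set \<Rightarrow> bool" where
  "dense_in_square Z d S \<longleftrightarrow>
     prod_topology (Metric_space.mtopology Z d) (Metric_space.mtopology Z d) closure_of S = Z \<times> Z"

definition densely_chaotic :: "'z set \<Rightarrow> ('z \<Rightarrow> 'z \<Rightarrow> real) \<Rightarrow> ('z \<Rightarrow> 'z) \<Rightarrow> bool" where
  "densely_chaotic Z d f \<longleftrightarrow> dense_in_square Z d (scrambled_pairs Z d f)"

definition densely_eps_chaotic ::
  "real \<Rightarrow> 'z set \<Rightarrow> ('z \<Rightarrow> 'z \<Rightarrow> real) \<Rightarrow> ('z \<Rightarrow> 'z) \<Rightarrow> bool" where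
  "densely_eps_chaotic \<epsilon> Z d f \<longleftrightarrow> dense_in_square Z d (eps_scrambled_pairs \<epsilon> Z d f)"

section \<open>Periodic and quasi-periodic points\<close>

definition periodic_point :: "('g \<Rightarrow> 'g) \<Rightarrow> 'g \<Rightarrow> bool" where
  "periodic_point \<phi> a \<longleftrightarrow> (\<exists>n\<ge>1. (\<phi> ^^ n) a = a)"

definition quasi_periodic_point :: "('g \<Rightarrow> 'g) \<Rightarrow> 'g \<Rightarrow> bool" where
  "quasi_periodic_point \<phi> a \<longleftrightarrow> (\<exists>n m. n > m \<and> m \<ge> 1 \<and> (\<phi> ^^ n) a = (\<phi> ^^ m) a)"

definition non_quasi_periodic_points :: "'g set \<Rightarrow> ('g \<Rightarrow> 'g) \<Rightarrow> 'g set" where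
  "non_quasi_periodic_points \<Gamma> \<phi> = {a \<in> \<Gamma>. \<not> quasi_periodic_point \<phi> a}"

section \<open>The space and the generalized shift\<close>

text \<open>
  The power of \<open>X\<close> with exponent \<open>\<Gamma>\<close> is the set \<open>\<Gamma> \<rightarrow>\<^sub>E X\<close> of extensional functions, so the shift has
  to be restricted to \<open>\<Gamma>\<close>.
\<close>

definition gen_shift :: "'g set \<Rightarrow> ('g \<Rightarrow> 'g) \<Rightarrow> ('g \<Rightarrow> 'x) \<Rightarrow> ('g \<Rightarrow> 'x)" where
  "gen_shift \<Gamma> \<phi> x = (\<lambda>\<alpha>\<in>\<Gamma>. x (\<phi> \<alpha>))"

text \<open>The indices of an enumeration: \<open>{1..card \<Gamma>}\<close> if \<open>\<Gamma>\<close> is finite, all \<open>n \<ge> 1\<close> otherwise.\<close>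

definition enum_indices :: "'g set \<Rightarrow> nat set" where
  "enum_indices \<Gamma> = (if finite \<Gamma> then {1..card \<Gamma>} else {1..})"

definition enumeration_of :: "'g set \<Rightarrow> (nat \<Rightarrow> 'g) \<Rightarrow> bool" where
  "enumeration_of \<Gamma> \<beta> \<longleftrightarrow> bij_betw \<beta> (enum_indices \<Gamma>) \<Gamma>"

definition discrete_dist :: "'x \<Rightarrow> 'x \<Rightarrow> real" where
  "discrete_dist a b = (if a = b then 0 else 1)"

definition shift_metric ::
  "'g set \<Rightarrow> (nat \<Rightarrow> 'g) \<Rightarrow> ('g \<Rightarrow> 'x) \<Rightarrow> ('g \<Rightarrow> 'x) \<Rightarrow> real" where
  "shift_metric \<Gamma> \<beta> x y = (\<Sum>\<^sub>\<infinity>n\<in>enum_indices \<Gamma>. discrete_dist (x (\<beta> n)) (y (\<beta> n)) / 2 ^ n)"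

section \<open>Compatibility of the metric with the product topology\<close>

lemma halves_has_sum: "((\<lambda>n. 1 / 2 ^ n :: real) has_sum 1 / 2 ^ M) {M<..}"
proof -
  have "((\<lambda>k. (1/2) ^ Suc M * (1/2) ^ k :: real) has_sum (1/2) ^ Suc M * 2) UNIV"
  proof (rule sums_nonneg_imp_has_sum)
    show "(\<lambda>k. (1/2) ^ Suc M * (1/2) ^ k :: real) sums ((1/2) ^ Suc M * 2)"
      using sums_mult[OF geometric_sums[of "1/2::real"], of "(1/2) ^ Suc M"] by simp
  qed auto
  moreover have "bij_betw (\<lambda>k. k + Suc M) UNIV {M<..}"
    by (rule bij_betw_byWitness[where f' = "\<lambda>n. n - Suc M"]) auto
  ultimately show ?thesis
    using has_sum_reindex_bij_betw[of "\<lambda>k. k + Suc M" UNIV "{M<..}"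
        "\<lambda>n. 1 / 2 ^ n :: real" "1 / 2 ^ M"]
    by (simp add: power_add power_one_over field_simps)
qed

lemma shift_metric_summable:
  fixes x y :: "'g \<Rightarrow> 'x"
  assumes "A \<subseteq> {M<..}"
  shows "(\<lambda>n. discrete_dist (x (\<beta> n)) (y (\<beta> n)) / 2 ^ n) summable_on A"
proof (rule summable_on_comparison_test)
  show "(\<lambda>n. 1 / 2 ^ n :: real) summable_on A"
    by (rule summable_on_subset_banach[OF has_sum_imp_summable[OF halves_has_sum] assms])
qed (auto simp: discrete_dist_def)

lemma enum_indices_pos: "enum_indices \<Gamma> \<subseteq> {0<..}"
  by (auto simp: enum_indices_def)

lemma shift_metric_term_le:
  assumes "n \<in> enum_indices \<Gamma>"
  shows "discrete_dist (x (\<beta> n)) (y (\<beta> n)) / 2 ^ n \<le> shift_metric \<Gamma> \<beta> x y"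
  using finite_sum_le_infsum[OF shift_metric_summable[OF enum_indices_pos], of "{n}" \<Gamma> x \<beta> y] assms
  by (auto simp: shift_metric_def discrete_dist_def)

lemma shift_metric_tail:
  assumes "\<And>n. n \<in> enum_indices \<Gamma> \<Longrightarrow> n \<le> M \<Longrightarrow> x (\<beta> n) = y (\<beta> n)"
  shows "shift_metric \<Gamma> \<beta> x y \<le> 1 / 2 ^ M"
proof -
  have "shift_metric \<Gamma> \<beta> x y \<le> (\<Sum>\<^sub>\<infinity>n\<in>{M<..}. 1 / 2 ^ n)"
    unfolding shift_metric_def
  proof (rule infsum_mono_neutral)
    show "(\<lambda>n. 1 / 2 ^ n :: real) summable_on {M<..}"
      by (rule has_sum_imp_summable[OF halves_has_sum])
  qed (use assms in \<open>auto simp: discrete_dist_def not_less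
        intro!: shift_metric_summable[OF enum_indices_pos, unfolded discrete_dist_def]\<close>)
  then show ?thesis
    by (simp only: infsumI[OF halves_has_sum])
qed

lemma Metric_space_shift_metric:
  assumes "enumeration_of \<Gamma> \<beta>"
  shows "Metric_space (\<Gamma> \<rightarrow>\<^sub>E X) (shift_metric \<Gamma> \<beta>)"
proof
  fix x y :: "'a \<Rightarrow> 'b"
  show "0 \<le> shift_metric \<Gamma> \<beta> x y"
    unfolding shift_metric_def by (rule infsum_nonneg) (simp add: discrete_dist_def)
  show "shift_metric \<Gamma> \<beta> x y = shift_metric \<Gamma> \<beta> y x"
    unfolding shift_metric_def discrete_dist_def by (simp add: eq_commute)
next
  fix x y :: "'a \<Rightarrow> 'b"
  assume xy: "x \<in> \<Gamma> \<rightarrow>\<^sub>E X" "y \<in> \<Gamma> \<rightarrow>\<^sub>E X"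
  show "shift_metric \<Gamma> \<beta> x y = 0 \<longleftrightarrow> x = y"
  proof
    assume 0: "shift_metric \<Gamma> \<beta> x y = 0"
    show "x = y"
    proof (rule PiE_ext[OF xy])
      fix i assume "i \<in> \<Gamma>"
      then obtain n where "n \<in> enum_indices \<Gamma>" "i = \<beta> n"
        using assms by (auto simp: enumeration_of_def bij_betw_def)
      then show "x i = y i"
        using shift_metric_term_le[of n \<Gamma> x \<beta> y] 0
        by (auto simp: discrete_dist_def power_le_zero_eq split: if_splits)
    qed
  qed (simp add: shift_metric_def discrete_dist_def)
next
  fix x y z :: "'a \<Rightarrow> 'b"
  note s = shift_metric_summable[OF enum_indices_pos[of \<Gamma>]]
  have "shift_metric \<Gamma> \<beta> x z \<le> (\<Sum>\<^sub>\<infinity>n\<in>enum_indices \<Gamma>.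
      discrete_dist (x (\<beta> n)) (y (\<beta> n)) / 2 ^ n + discrete_dist (y (\<beta> n)) (z (\<beta> n)) / 2 ^ n)"
    unfolding shift_metric_def
    by (intro infsum_mono summable_on_add s) (auto simp: discrete_dist_def)
  also have "\<dots> = shift_metric \<Gamma> \<beta> x y + shift_metric \<Gamma> \<beta> y z"
    unfolding shift_metric_def by (intro infsum_add s)
  finally show "shift_metric \<Gamma> \<beta> x z \<le> shift_metric \<Gamma> \<beta> x y + shift_metric \<Gamma> \<beta> y z" .
qed

lemma mtopology_shift_metric:
  assumes "enumeration_of \<Gamma> \<beta>"
  shows "Metric_space.mtopology (\<Gamma> \<rightarrow>\<^sub>E X) (shift_metric \<Gamma> \<beta>) =
    product_topology (\<lambda>_. discrete_topology X) \<Gamma>"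
proof -
  interpret Metric_space "\<Gamma> \<rightarrow>\<^sub>E X" "shift_metric \<Gamma> \<beta>"
    by (rule Metric_space_shift_metric[OF assms])
  have \<beta>: "\<beta> n \<in> \<Gamma>" if "n \<in> enum_indices \<Gamma>" for n
    using assms that by (auto simp: enumeration_of_def bij_betw_def)
  have "openin mtopology S" if S: "openin (product_topology (\<lambda>_. discrete_topology X) \<Gamma>) S" for S
    unfolding openin_mtopology
  proof (intro conjI allI impI)
    show sub: "S \<subseteq> \<Gamma> \<rightarrow>\<^sub>E X"
      using openin_subset[OF S] by simp
    fix x assume x: "x \<in> S"
    then obtain U where U: "finite {i \<in> \<Gamma>. U i \<noteq> X}" "x \<in> Pi\<^sub>E \<Gamma> U" "Pi\<^sub>E \<Gamma> U \<subseteq> S"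
      using S by (fastforce simp: openin_product_topology_alt)
    have "inj_on \<beta> (enum_indices \<Gamma>)"
      using assms by (simp add: enumeration_of_def bij_betw_def)
    then have "finite (\<beta> -` {i \<in> \<Gamma>. U i \<noteq> X} \<inter> enum_indices \<Gamma>)"
      by (rule finite_vimage_IntI[OF U(1)])
    then obtain M where M: "\<And>n. n \<in> \<beta> -` {i \<in> \<Gamma>. U i \<noteq> X} \<inter> enum_indices \<Gamma> \<Longrightarrow> n \<le> M"
      unfolding finite_nat_set_iff_bounded_le by (elim exE) (rule that, rule bspec)
    have "y \<in> S" if y: "y \<in> mball x (1 / 2 ^ M)" for y
    proof -
      have yD: "y \<in> \<Gamma> \<rightarrow>\<^sub>E X" and d: "shift_metric \<Gamma> \<beta> x y < 1 / 2 ^ M"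
        using y by auto
      have "y i \<in> U i" if i: "i \<in> \<Gamma>" for i
      proof (cases "U i = X")
        case True
        then show ?thesis using yD i by auto
      next
        case False
        obtain n where n: "n \<in> enum_indices \<Gamma>" "i = \<beta> n"
          using assms i by (auto simp: enumeration_of_def bij_betw_def)
        with False i have "n \<le> M" using M by auto
        then have "(1::real) / 2 ^ M \<le> 1 / 2 ^ n"
          by (simp add: frac_le)
        with d shift_metric_term_le[OF n(1), of x \<beta> y] have "x i = y i"
          using n by (auto simp: discrete_dist_def split: if_splits)
        then show ?thesis using PiE_mem[OF U(2) i] by simp
      qed
      then have "y \<in> Pi\<^sub>E \<Gamma> U" using yD by (auto simp: PiE_iff)
      then show ?thesis using U(3) by auto
    qed
    then show "\<exists>r>0. mball x r \<subseteq> S"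
      by (intro exI[of _ "1 / 2 ^ M"]) auto
  qed
  moreover have "openin (product_topology (\<lambda>_. discrete_topology X) \<Gamma>) S"
    if S: "openin mtopology S" for S
    unfolding openin_product_topology_alt
  proof (intro ballI)
    fix x assume x: "x \<in> S"
    then have xD: "x \<in> \<Gamma> \<rightarrow>\<^sub>E X" using S openin_mtopology by auto
    obtain r where r: "r > 0" "mball x r \<subseteq> S" using S x openin_mtopology by auto
    obtain M where M: "(1/2::real) ^ M < r"
      using real_arch_pow_inv[OF r(1), of "1/2"] by auto
    define F where "F = \<beta> ` (enum_indices \<Gamma> \<inter> {..M})"
    define U where "U = (\<lambda>i. if i \<in> F then {x i} else X)"
    have "finite F" by (simp add: F_def)
    have "y \<in> mball x r" if y: "y \<in> Pi\<^sub>E \<Gamma> U" for y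
    proof -
      have yD: "y \<in> \<Gamma> \<rightarrow>\<^sub>E X"
      proof (rule PiE_I)
        fix i assume "i \<in> \<Gamma>"
        then have "y i \<in> U i" "x i \<in> X" using y xD by auto
        then show "y i \<in> X" by (simp add: U_def split: if_splits)
      next
        fix i assume "i \<notin> \<Gamma>"
        then show "y i = undefined" by (rule PiE_arb[OF y])
      qed
      have "x (\<beta> n) = y (\<beta> n)" if "n \<in> enum_indices \<Gamma>" "n \<le> M" for n
      proof -
        have "\<beta> n \<in> F" using that by (auto simp: F_def)
        then show ?thesis using y \<beta>[OF that(1)] by (auto simp: PiE_iff U_def)
      qed
      then have "shift_metric \<Gamma> \<beta> x y \<le> 1 / 2 ^ M" by (rule shift_metric_tail)
      then show ?thesis using M xD yD by (simp add: power_one_over)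
    qed
    moreover have "finite {i \<in> \<Gamma>. U i \<noteq> X}"
      by (rule finite_subset[OF _ \<open>finite F\<close>]) (auto simp: U_def)
    ultimately show "\<exists>U. finite {i \<in> \<Gamma>. U i \<noteq> topspace (discrete_topology X)} \<and>
        (\<forall>i\<in>\<Gamma>. openin (discrete_topology X) (U i)) \<and> x \<in> Pi\<^sub>E \<Gamma> U \<and> Pi\<^sub>E \<Gamma> U \<subseteq> S"
      using xD r(2) by (intro exI[of _ U]) (auto simp: U_def PiE_iff)
  qed
  ultimately show ?thesis
    by (auto simp: topology_eq)
qed

lemma compact_space_shift_metric:
  assumes "enumeration_of \<Gamma> \<beta>" "finite X"
  shows "compact_space (Metric_space.mtopology (\<Gamma> \<rightarrow>\<^sub>E X) (shift_metric \<Gamma> \<beta>))"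
  using assms
  by (simp add: mtopology_shift_metric compact_space_product_topology compact_space_discrete_topology)

lemma continuous_map_gen_shift:
  assumes "enumeration_of \<Gamma> \<beta>" "\<phi> \<in> \<Gamma> \<rightarrow> \<Gamma>"
  shows "continuous_map (Metric_space.mtopology (\<Gamma> \<rightarrow>\<^sub>E X) (shift_metric \<Gamma> \<beta>))
    (Metric_space.mtopology (\<Gamma> \<rightarrow>\<^sub>E X) (shift_metric \<Gamma> \<beta>)) (gen_shift \<Gamma> \<phi>)"
  unfolding mtopology_shift_metric[OF assms(1)] continuous_map_componentwise
proof (intro conjI ballI)
  fix k assume k: "k \<in> \<Gamma>"
  then have "\<phi> k \<in> \<Gamma>" using assms(2) by auto
  from continuous_map_product_projection[OF this, of "\<lambda>_. discrete_topology X"] k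
  show "continuous_map (product_topology (\<lambda>_. discrete_topology X) \<Gamma>) (discrete_topology X)
    (\<lambda>x. gen_shift \<Gamma> \<phi> x k)"
    by (simp add: gen_shift_def)
qed (auto simp: gen_shift_def)

end

theory Submission
  imports Defs
begin

text \<open>
  The \<open>n\<close>-th iterate of the shift reads off the coordinates \<open>(\<phi> ^^ n) \<alpha>\<close>, so the behaviour of a
  pair \<open>(x, y)\<close> is determined by which forward orbits of \<open>\<phi>\<close> meet the set where \<open>x\<close> and \<open>y\<close> differ.
  Since \<open>X\<close> is discrete, a set of pairs is dense exactly when every pair can be changed, outside
  an arbitrary finite set of coordinates, to a member of the set (\<open>dense_in_square_iff\<close>).

  If \<open>a\<close> is periodic, its orbit is a finite set of coordinates, and pairs that differ everywhere on
  it keep differing at the coordinate \<open>a\<close> forever. No such pair is scrambled, and by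
  \<open>dense_in_square_iff\<close> this excludes dense chaos.

  If there is no periodic point, every forward orbit is injective and hence leaves every finite set
  for good. Two sets \<open>D\<close> and \<open>E\<close> of coordinates can then be built by alternately adding finitely
  many points far out on orbits (\<open>disjoint_orbit_targets\<close>): the orbit of \<open>\<beta> 1\<close> is in \<open>D\<close> infinitely
  often, and for every \<open>j\<close> there are late times at which the orbits of \<open>\<beta> 1, \<dots>, \<beta> j\<close> are in \<open>E\<close>
  simultaneously. Two points that differ on \<open>D\<close> and agree on \<open>E\<close> have iterates that are infinitely
  often at distance at least \<open>1/2\<close>, and come arbitrarily close. As \<open>D\<close> and \<open>E\<close> avoid any prescribed
  finite set, this gives dense \<open>\<epsilon>\<close>-chaos, for instance with \<open>\<epsilon> = 1/4\<close>.
\<close>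

section \<open>Orbits and periodic points\<close>

lemma funpow_mem:
  assumes "\<phi> \<in> \<Gamma> \<rightarrow> \<Gamma>" "a \<in> \<Gamma>"
  shows "(\<phi> ^^ n) a \<in> \<Gamma>"
  using assms by (induction n) auto

lemma funpow_eq_imp_periodic:
  assumes "(\<phi> ^^ n) a = (\<phi> ^^ m) a" "m < n"
  shows "periodic_point \<phi> ((\<phi> ^^ m) a)"
proof -
  have "(\<phi> ^^ (n - m)) ((\<phi> ^^ m) a) = (\<phi> ^^ (n - m + m)) a"
    by (simp add: funpow_add)
  with assms show ?thesis
    unfolding periodic_point_def by (intro exI[of _ "n - m"]) simp
qed

lemma periodic_imp_quasi_periodic:
  assumes "periodic_point \<phi> a"
  shows "quasi_periodic_point \<phi> a"
proof -
  obtain n where "n \<ge> 1" "(\<phi> ^^ n) a = a"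
    using assms by (auto simp: periodic_point_def)
  then show ?thesis
    unfolding quasi_periodic_point_def by (intro exI[of _ "Suc n"] exI[of _ 1]) auto
qed

lemma no_periodic_iff_non_quasi_periodic:
  assumes "\<phi> \<in> \<Gamma> \<rightarrow> \<Gamma>"
  shows "\<not> (\<exists>a\<in>\<Gamma>. periodic_point \<phi> a) \<longleftrightarrow> non_quasi_periodic_points \<Gamma> \<phi> = \<Gamma>"
proof -
  have "\<exists>b\<in>\<Gamma>. periodic_point \<phi> b" if "a \<in> \<Gamma>" "quasi_periodic_point \<phi> a" for a
  proof -
    obtain n m where "m < n" "(\<phi> ^^ n) a = (\<phi> ^^ m) a"
      using \<open>quasi_periodic_point \<phi> a\<close> by (auto simp: quasi_periodic_point_def)
    then show ?thesis
      using funpow_eq_imp_periodic funpow_mem[OF assms \<open>a \<in> \<Gamma>\<close>] by meson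
  qed
  then show ?thesis
    using periodic_imp_quasi_periodic[of \<phi>] by (auto simp: non_quasi_periodic_points_def)
qed

lemma inj_orbit:
  assumes "\<phi> \<in> \<Gamma> \<rightarrow> \<Gamma>" "\<not> (\<exists>a\<in>\<Gamma>. periodic_point \<phi> a)" "a \<in> \<Gamma>"
  shows "inj (\<lambda>n. (\<phi> ^^ n) a)"
proof (rule linorder_injI)
  fix m n :: nat
  assume "m < n"
  then show "(\<phi> ^^ m) a \<noteq> (\<phi> ^^ n) a"
    using funpow_eq_imp_periodic[of n \<phi> a m] funpow_mem[OF assms(1,3)] assms(2) by metis
qed

text \<open>After the first full period the orbit only repeats, so it is the image of \<open>{..<n}\<close>.\<close>

lemma finite_orbit:
  assumes "periodic_point \<phi> a"
  shows "finite (range (\<lambda>n. (\<phi> ^^ n) a))"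
proof -
  obtain n where n: "n \<ge> 1" "(\<phi> ^^ n) a = a"
    using assms by (auto simp: periodic_point_def)
  have "(\<phi> ^^ k) a \<in> (\<lambda>i. (\<phi> ^^ i) a) ` {..<n}" for k
    using n(1) funpow_mod_eq[OF n(2), of k] by (intro image_eqI[of _ _ "k mod n"]) auto
  then show ?thesis
    by (intro finite_subset[OF _ finite_imageI[OF finite_lessThan]]) auto
qed

section \<open>Iterates of the shift\<close>

lemma gen_shift_funpow:
  assumes "\<phi> \<in> \<Gamma> \<rightarrow> \<Gamma>" "\<alpha> \<in> \<Gamma>"
  shows "(gen_shift \<Gamma> \<phi> ^^ n) x \<alpha> = x ((\<phi> ^^ n) \<alpha>)"
  using assms(2)
proof (induction n arbitrary: \<alpha>)
  case (Suc n)
  have "(gen_shift \<Gamma> \<phi> ^^ Suc n) x \<alpha> = (gen_shift \<Gamma> \<phi> ^^ n) x (\<phi> \<alpha>)"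
    using Suc.prems by (simp add: gen_shift_def)
  also have "\<dots> = x ((\<phi> ^^ n) (\<phi> \<alpha>))"
    using Suc assms(1) by (intro Suc.IH) auto
  finally show ?case
    by (simp add: funpow_swap1)
qed simp

lemma shift_metric_ge:
  assumes "n \<in> enum_indices \<Gamma>" "x (\<beta> n) \<noteq> y (\<beta> n)"
  shows "1 / 2 ^ n \<le> shift_metric \<Gamma> \<beta> x y"
  using shift_metric_term_le[OF assms(1), of x \<beta> y] assms(2) by (simp add: discrete_dist_def)

lemma liminf_eq_0I:
  fixes d :: "nat \<Rightarrow> real"
  assumes nonneg: "\<And>n. 0 \<le> d n" and small: "\<And>j. \<exists>n\<ge>j. d n \<le> 1 / 2 ^ j"
  shows "liminf (\<lambda>n. ereal (d n)) = 0"
proof (rule antisym)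
  show "0 \<le> liminf (\<lambda>n. ereal (d n))"
    by (rule Liminf_bounded) (simp add: nonneg)
  show "liminf (\<lambda>n. ereal (d n)) \<le> 0"
  proof (rule ccontr)
    assume "\<not> ?thesis"
    then obtain e where e: "0 < e" "ereal e < liminf (\<lambda>n. ereal (d n))"
      using ereal_dense2[of 0 "liminf (\<lambda>n. ereal (d n))"] by (auto simp: not_le)
    obtain N where N: "\<And>n. n \<ge> N \<Longrightarrow> e < d n"
      using less_LiminfD[OF e(2)] by (auto simp: eventually_sequentially)
    obtain M where M: "(1/2::real) ^ M < e"
      using real_arch_pow_inv[OF e(1), of "1/2"] by auto
    obtain n where n: "n \<ge> max M N" "d n \<le> 1 / 2 ^ max M N"
      using small by blast
    have "(1::real) / 2 ^ max M N \<le> 1 / 2 ^ M"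
      by (simp add: frac_le)
    with n M N[of n] show False
      by (simp add: power_one_over)
  qed
qed

lemma less_limsupI:
  fixes d :: "nat \<Rightarrow> real"
  assumes "\<And>j. \<exists>n\<ge>j. c \<le> d n" "e < c"
  shows "ereal e < limsup (\<lambda>n. ereal (d n))"
proof (rule ccontr)
  assume "\<not> ?thesis"
  then have "limsup (\<lambda>n. ereal (d n)) < ereal c"
    using assms(2) by (meson ereal_less_le leI less_ereal.simps(1) order_le_less_trans)
  from Limsup_lessD[OF this] obtain N where "\<And>n. n \<ge> N \<Longrightarrow> d n < c"
    by (auto simp: eventually_sequentially)
  with assms(1)[of N] show False
    by force
qed

section \<open>Dense sets of pairs\<close>

text \<open>
  The cylinders fixing finitely many coordinates form a neighbourhood base at each point of the
  product of discrete spaces.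
\<close>

lemma dense_in_square_iff:
  assumes \<beta>: "enumeration_of \<Gamma> \<beta>" and S: "S \<subseteq> (\<Gamma> \<rightarrow>\<^sub>E X) \<times> (\<Gamma> \<rightarrow>\<^sub>E X)"
  shows "dense_in_square (\<Gamma> \<rightarrow>\<^sub>E X) (shift_metric \<Gamma> \<beta>) S \<longleftrightarrow>
    (\<forall>x\<in>\<Gamma> \<rightarrow>\<^sub>E X. \<forall>y\<in>\<Gamma> \<rightarrow>\<^sub>E X. \<forall>F\<subseteq>\<Gamma>. finite F \<longrightarrow>
      (\<exists>(x', y')\<in>S. \<forall>i\<in>F. x' i = x i \<and> y' i = y i))"
    (is "_ \<longleftrightarrow> ?approx")
proof -
  define P where "P = product_topology (\<lambda>_. discrete_topology X) \<Gamma>"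
  have top: "topspace P = \<Gamma> \<rightarrow>\<^sub>E X"
    by (simp add: P_def)
  have "dense_in_square (\<Gamma> \<rightarrow>\<^sub>E X) (shift_metric \<Gamma> \<beta>) S \<longleftrightarrow>
      prod_topology P P closure_of S = (\<Gamma> \<rightarrow>\<^sub>E X) \<times> (\<Gamma> \<rightarrow>\<^sub>E X)"
    unfolding dense_in_square_def mtopology_shift_metric[OF \<beta>] P_def ..
  also have "\<dots> \<longleftrightarrow> ?approx"
  proof
    assume dense: "prod_topology P P closure_of S = (\<Gamma> \<rightarrow>\<^sub>E X) \<times> (\<Gamma> \<rightarrow>\<^sub>E X)"
    show ?approx
    proof (intro ballI allI impI)
      fix x y F
      assume xy: "x \<in> \<Gamma> \<rightarrow>\<^sub>E X" "y \<in> \<Gamma> \<rightarrow>\<^sub>E X" and F: "F \<subseteq> \<Gamma>" "finite F"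
      define cyl where "cyl = (\<lambda>z. \<Pi>\<^sub>E i\<in>\<Gamma>. if i \<in> F then {z i} else X)"
      have cyl: "openin P (cyl z)" "z \<in> cyl z" if z: "z \<in> \<Gamma> \<rightarrow>\<^sub>E X" for z
      proof -
        have "finite {i \<in> \<Gamma>. (if i \<in> F then {z i} else X) \<noteq> X}"
          by (rule finite_subset[OF _ F(2)]) auto
        moreover have "openin (discrete_topology X) (if i \<in> F then {z i} else X)" if "i \<in> \<Gamma>" for i
          using PiE_mem[OF z that] by simp
        ultimately show "openin P (cyl z)"
          unfolding P_def cyl_def openin_PiE_gen by simp
        show "z \<in> cyl z"
          using z by (auto simp: cyl_def PiE_iff)
      qed
      have "(x, y) \<in> prod_topology P P closure_of S"
        using dense xy by simp
      moreover have "openin (prod_topology P P) (cyl x \<times> cyl y)" "(x, y) \<in> cyl x \<times> cyl y"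
        using cyl xy by (auto simp: openin_prod_Times_iff)
      ultimately obtain p where "p \<in> S" "p \<in> cyl x \<times> cyl y"
        unfolding in_closure_of by meson
      then obtain x' y' where "(x', y') \<in> S" "x' \<in> cyl x" "y' \<in> cyl y"
        by (cases p) auto
      moreover have "z' i = z i" if "z' \<in> cyl z" "i \<in> F" for z z' i
        using that F(1) PiE_mem[of z' \<Gamma> "\<lambda>i. if i \<in> F then {z i} else X" i] by (auto simp: cyl_def)
      ultimately show "\<exists>(x', y')\<in>S. \<forall>i\<in>F. x' i = x i \<and> y' i = y i"
        by blast
    qed
  next
    assume approx: ?approx
    have "(x, y) \<in> prod_topology P P closure_of S"
      if xy: "x \<in> \<Gamma> \<rightarrow>\<^sub>E X" "y \<in> \<Gamma> \<rightarrow>\<^sub>E X" for x y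
      unfolding in_closure_of
    proof (intro conjI allI impI)
      show "(x, y) \<in> topspace (prod_topology P P)"
        using xy top by simp
      fix T
      assume "(x, y) \<in> T \<and> openin (prod_topology P P) T"
      then obtain A B where AB: "openin P A" "openin P B" "x \<in> A" "y \<in> B" "A \<times> B \<subseteq> T"
        unfolding openin_prod_topology_alt by meson
      obtain U where U: "finite {i \<in> \<Gamma>. U i \<noteq> X}" "x \<in> Pi\<^sub>E \<Gamma> U" "Pi\<^sub>E \<Gamma> U \<subseteq> A"
        using AB(1,3) unfolding P_def by (fastforce simp: openin_product_topology_alt)
      obtain V where V: "finite {i \<in> \<Gamma>. V i \<noteq> X}" "y \<in> Pi\<^sub>E \<Gamma> V" "Pi\<^sub>E \<Gamma> V \<subseteq> B"
        using AB(2,4) unfolding P_def by (fastforce simp: openin_product_topology_alt)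
      define F where "F = {i \<in> \<Gamma>. U i \<noteq> X} \<union> {i \<in> \<Gamma>. V i \<noteq> X}"
      have F: "F \<subseteq> \<Gamma>" "finite F"
        using U(1) V(1) by (auto simp: F_def)
      obtain x' y' where S': "(x', y') \<in> S" and eq: "\<And>i. i \<in> F \<Longrightarrow> x' i = x i \<and> y' i = y i"
        using approx[rule_format, OF xy F] by blast
      have Z: "x' \<in> \<Gamma> \<rightarrow>\<^sub>E X" "y' \<in> \<Gamma> \<rightarrow>\<^sub>E X"
        using S S' by auto
      have mem: "z' \<in> Pi\<^sub>E \<Gamma> W"
        if "z \<in> Pi\<^sub>E \<Gamma> W" "z' \<in> \<Gamma> \<rightarrow>\<^sub>E X" "\<And>i. i \<in> \<Gamma> \<Longrightarrow> W i \<noteq> X \<Longrightarrow> z' i = z i" for z z' W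
      proof (rule PiE_I)
        fix i assume "i \<in> \<Gamma>"
        then show "z' i \<in> W i"
          using that by (cases "W i = X") (auto dest: PiE_mem)
      next
        fix i assume "i \<notin> \<Gamma>"
        then show "z' i = undefined"
          using that(2) by (rule PiE_arb[rotated])
      qed
      have "x' \<in> Pi\<^sub>E \<Gamma> U"
        by (rule mem[OF U(2) Z(1)]) (auto simp: eq F_def)
      moreover have "y' \<in> Pi\<^sub>E \<Gamma> V"
        by (rule mem[OF V(2) Z(2)]) (auto simp: eq F_def)
      ultimately show "\<exists>p. p \<in> S \<and> p \<in> T"
        using S' U(3) V(3) AB(5) by blast
    qed
    then show "prod_topology P P closure_of S = (\<Gamma> \<rightarrow>\<^sub>E X) \<times> (\<Gamma> \<rightarrow>\<^sub>E X)"
      using closure_of_subset_topspace[of "prod_topology P P" S] top by auto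
  qed
  finally show ?thesis .
qed

lemma scrambled_pairs_subset: "scrambled_pairs Z d f \<subseteq> Z \<times> Z"
  by (auto simp: scrambled_pairs_def)

lemma eps_scrambled_pairs_subset: "eps_scrambled_pairs \<epsilon> Z d f \<subseteq> scrambled_pairs Z d f"
  by (auto simp: eps_scrambled_pairs_def)

lemma densely_eps_chaotic_imp_densely_chaotic:
  assumes "densely_eps_chaotic \<epsilon> Z d f" "Metric_space Z d"
  shows "densely_chaotic Z d f"
proof -
  let ?P = "prod_topology (Metric_space.mtopology Z d) (Metric_space.mtopology Z d)"
  have "?P closure_of eps_scrambled_pairs \<epsilon> Z d f \<subseteq> ?P closure_of scrambled_pairs Z d f"
    by (rule closure_of_mono[OF eps_scrambled_pairs_subset])
  moreover have "topspace ?P = Z \<times> Z"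
    using assms(2) by (simp add: Metric_space.topspace_mtopology)
  ultimately show ?thesis
    using assms(1) closure_of_subset_topspace[of ?P]
    unfolding densely_eps_chaotic_def densely_chaotic_def dense_in_square_def by blast
qed

section \<open>A periodic point excludes dense chaos\<close>

lemma two_elements:
  assumes "card X \<ge> 2"
  obtains u v where "u \<in> X" "v \<in> X" "u \<noteq> v"
  using assms card_le_Suc0_iff_eq[of X] card.infinite[of X] by force

text \<open>
  If \<open>a = \<beta> k\<close> is periodic, density provides a scrambled pair that is constant with two different
  values along the finite orbit of \<open>a\<close>. Its iterates always differ at the coordinate \<open>a\<close>, hence stay
  at distance at least \<open>1 / 2 ^ k\<close>, and the lower limit cannot vanish.
\<close>

lemma densely_chaotic_imp_no_periodic:
  fixes X :: "'x set" and \<Gamma> :: "'g set"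
  assumes X: "card X \<ge> 2" and \<phi>: "\<phi> \<in> \<Gamma> \<rightarrow> \<Gamma>" and \<beta>: "enumeration_of \<Gamma> \<beta>"
    and chaos: "densely_chaotic (\<Gamma> \<rightarrow>\<^sub>E X) (shift_metric \<Gamma> \<beta>) (gen_shift \<Gamma> \<phi>)"
  shows "\<not> (\<exists>a\<in>\<Gamma>. periodic_point \<phi> a)"
proof
  assume "\<exists>a\<in>\<Gamma>. periodic_point \<phi> a"
  then obtain a where a: "a \<in> \<Gamma>" "periodic_point \<phi> a" ..
  obtain u v where uv: "u \<in> X" "v \<in> X" "u \<noteq> v"
    using two_elements[OF X] .
  let ?O = "range (\<lambda>n. (\<phi> ^^ n) a)"
  have O: "?O \<subseteq> \<Gamma>"
    using funpow_mem[OF \<phi> a(1)] by auto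
  define const where "const = (\<lambda>c::'x. \<lambda>i\<in>\<Gamma>. c)"
  have "const u \<in> \<Gamma> \<rightarrow>\<^sub>E X" "const v \<in> \<Gamma> \<rightarrow>\<^sub>E X"
    using uv by (auto simp: const_def)
  with chaos O finite_orbit[OF a(2)]
  have "\<exists>(x, y)\<in>scrambled_pairs (\<Gamma> \<rightarrow>\<^sub>E X) (shift_metric \<Gamma> \<beta>) (gen_shift \<Gamma> \<phi>).
      \<forall>i\<in>?O. x i = const u i \<and> y i = const v i"
    unfolding densely_chaotic_def dense_in_square_iff[OF \<beta> scrambled_pairs_subset] by meson
  then obtain x y where xy: "(x, y) \<in> scrambled_pairs (\<Gamma> \<rightarrow>\<^sub>E X) (shift_metric \<Gamma> \<beta>) (gen_shift \<Gamma> \<phi>)"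
    and eq: "\<And>i. i \<in> ?O \<Longrightarrow> x i = const u i \<and> y i = const v i"
    by blast
  obtain k where k: "k \<in> enum_indices \<Gamma>" "a = \<beta> k"
    using \<beta> a(1) by (auto simp: enumeration_of_def bij_betw_def)
  let ?d = "\<lambda>n. shift_metric \<Gamma> \<beta> ((gen_shift \<Gamma> \<phi> ^^ n) x) ((gen_shift \<Gamma> \<phi> ^^ n) y)"
  have "1 / 2 ^ k \<le> ?d n" for n
  proof (rule shift_metric_ge[OF k(1)])
    have "(\<phi> ^^ n) a \<in> ?O"
      by simp
    with eq[OF this] O uv(3) have "x ((\<phi> ^^ n) a) \<noteq> y ((\<phi> ^^ n) a)"
      by (auto simp: const_def)
    then show "(gen_shift \<Gamma> \<phi> ^^ n) x (\<beta> k) \<noteq> (gen_shift \<Gamma> \<phi> ^^ n) y (\<beta> k)"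
      using gen_shift_funpow[OF \<phi> a(1)] k(2) by metis
  qed
  then have "ereal (1 / 2 ^ k) \<le> liminf (\<lambda>n. ereal (?d n))"
    by (intro Liminf_bounded) simp
  moreover have "liminf (\<lambda>n. ereal (?d n)) = 0"
    using xy by (simp add: scrambled_pairs_def)
  ultimately have "(1::real) / 2 ^ k \<le> 0"
    by (metis ereal_less_eq(3) zero_ereal_def)
  then show False
    using zero_less_power[of "2::real" k] by (simp add: not_le[symmetric] del: zero_less_power)
qed

section \<open>Dense chaos in the absence of periodic points\<close>

lemma inj_eventually_avoids:
  fixes s :: "nat \<Rightarrow> 'g"
  assumes "inj s" "finite A"
  shows "\<forall>\<^sub>F n in sequentially. s n \<notin> A"
proof -
  have "finite (s -` A)"
    using finite_vimageI[OF assms(2,1)] .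
  then show ?thesis
    by (simp add: cofinite_eq_sequentially[symmetric] eventually_cofinite vimage_def)
qed

text \<open>
  The sets \<open>D\<close> and \<open>E\<close> are unions of increasing sequences of finite sets. At stage \<open>j\<close> only
  finitely many points have been used, and only finitely many sequences are considered, so at
  some late time all of them have left those points behind: the values there can be added to
  \<open>D\<close> or to \<open>E\<close> without creating a common point.
\<close>

lemma disjoint_orbit_targets:
  fixes s :: "nat \<Rightarrow> nat \<Rightarrow> 'g"
  assumes inj: "\<And>k. k \<in> I \<Longrightarrow> inj (s k)" and l: "l \<in> I" and F: "finite F"
  obtains D E where "D \<inter> E = {}" "D \<inter> F = {}" "E \<inter> F = {}"
    and "\<And>j. \<exists>n\<ge>j. s l n \<in> D"
    and "\<And>j. \<exists>n\<ge>j. \<forall>k\<in>I \<inter> {..j}. s k n \<in> E"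
proof -
  define good where "good = (\<lambda>(D, E). finite D \<and> finite E \<and> D \<inter> E = {} \<and> D \<inter> F = {} \<and> E \<inter> F = {})"
  define next_stage where "next_stage = (\<lambda>j (D, E) (D', E'). D \<subseteq> D' \<and> E \<subseteq> E' \<and>
    (\<exists>n\<ge>j. s l n \<in> D') \<and> (\<exists>n\<ge>j. \<forall>k\<in>I \<inter> {..j}. s k n \<in> E'))"
  have step: "\<exists>q. good q \<and> next_stage j p q" if p: "good p" for p j
  proof -
    obtain D E where DE: "p = (D, E)" "finite D" "finite E" "D \<inter> E = {}" "D \<inter> F = {}" "E \<inter> F = {}"
      using p by (cases p) (auto simp: good_def)
    have "\<forall>\<^sub>F n in sequentially. s l n \<notin> E \<union> F"
      using inj_eventually_avoids[OF inj[OF l]] DE F by blast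
    then have "\<forall>\<^sub>F n in sequentially. j \<le> n \<and> s l n \<notin> E \<union> F"
      using eventually_ge_at_top[of j] by eventually_elim simp
    then obtain n where n: "j \<le> n" "s l n \<notin> E \<union> F"
      using eventually_happens'[OF sequentially_bot] by blast
    \<comment> \<open>The points added to \<open>E\<close> are chosen after \<open>s l n\<close>, so that they can avoid it too.\<close>
    have "\<forall>\<^sub>F m in sequentially. \<forall>k\<in>I \<inter> {..j}. s k m \<notin> insert (s l n) D \<union> F"
    proof (rule eventually_ball_finite)
      show "\<forall>k\<in>I \<inter> {..j}. \<forall>\<^sub>F m in sequentially. s k m \<notin> insert (s l n) D \<union> F"
        using DE F by (intro ballI inj_eventually_avoids inj) auto
    qed simp
    then have "\<forall>\<^sub>F m in sequentially. j \<le> m \<and> (\<forall>k\<in>I \<inter> {..j}. s k m \<notin> insert (s l n) D \<union> F)"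
      using eventually_ge_at_top[of j] by eventually_elim simp
    then obtain m where m: "j \<le> m" "\<And>k. k \<in> I \<inter> {..j} \<Longrightarrow> s k m \<notin> insert (s l n) D \<union> F"
      using eventually_happens'[OF sequentially_bot] by blast
    let ?q = "(insert (s l n) D, E \<union> (\<lambda>k. s k m) ` (I \<inter> {..j}))"
    have "good ?q"
      using DE n m(2) unfolding good_def by fastforce
    moreover have "next_stage j p ?q"
      using DE(1) n(1) m(1) by (auto simp: next_stage_def)
    ultimately show ?thesis
      by blast
  qed
  have "good ({}, {})"
    by (simp add: good_def)
  then obtain p where p: "\<And>j. good (p j)" "\<And>j. next_stage j (p j) (p (Suc j))"
    using dependent_nat_choice[of "\<lambda>_. good" next_stage] step by metis
  define D where "D = (\<lambda>j. fst (p j))"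
  define E where "E = (\<lambda>j. snd (p j))"
  have pDE: "p j = (D j, E j)" for j
    by (simp add: D_def E_def)
  have good: "D j \<inter> E j = {}" "D j \<inter> F = {}" "E j \<inter> F = {}" for j
    using p(1)[of j] by (auto simp: pDE good_def)
  have stage: "D j \<subseteq> D (Suc j)" "E j \<subseteq> E (Suc j)" "\<exists>n\<ge>j. s l n \<in> D (Suc j)"
      "\<exists>n\<ge>j. \<forall>k\<in>I \<inter> {..j}. s k n \<in> E (Suc j)" for j
    using p(2)[of j] by (auto simp: pDE next_stage_def)
  have mono: "D i \<subseteq> D j" "E i \<subseteq> E j" if "i \<le> j" for i j
    using lift_Suc_mono_le[of D, OF stage(1) that] lift_Suc_mono_le[of E, OF stage(2) that] by auto
  have "(\<Union>j. D j) \<inter> (\<Union>j. E j) = {}"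
  proof -
    have "D i \<inter> E j = {}" for i j
      using good(1)[of "max i j"] mono[of i "max i j"] mono[of j "max i j"] by fastforce
    then show ?thesis
      by blast
  qed
  moreover have "(\<Union>j. D j) \<inter> F = {}" "(\<Union>j. E j) \<inter> F = {}"
    using good by blast+
  moreover have "\<exists>n\<ge>j. s l n \<in> (\<Union>j. D j)" for j
    using stage(3)[of j] by blast
  moreover have "\<exists>n\<ge>j. \<forall>k\<in>I \<inter> {..j}. s k n \<in> (\<Union>j. E j)" for j
    using stage(4)[of j] by blast
  ultimately show ?thesis
    by (rule that)
qed

text \<open>
  Outside the prescribed finite set \<open>F\<close> the new pair agrees except on \<open>D\<close>. Whenever the orbit of \<open>\<beta> 1\<close>
  is in \<open>D\<close>, the iterates differ at the coordinate of weight \<open>1 / 2\<close>, which is where the bound on \<open>\<epsilon>\<close>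
  comes from. Whenever the orbits of \<open>\<beta> 1, \<dots>, \<beta> j\<close> are all in \<open>E\<close>, only the tail of the
  series after \<open>j\<close> contributes to the distance. For the latter \<open>E\<close> has to avoid \<open>F\<close> as well, since
  the values on \<open>F\<close> are prescribed and may differ.
\<close>

lemma no_periodic_imp_densely_eps_chaotic:
  fixes X :: "'x set" and \<Gamma> :: "'g set"
  assumes X: "card X \<ge> 2" and \<Gamma>: "\<Gamma> \<noteq> {}" and \<phi>: "\<phi> \<in> \<Gamma> \<rightarrow> \<Gamma>" and \<beta>: "enumeration_of \<Gamma> \<beta>"
    and no_per: "\<not> (\<exists>a\<in>\<Gamma>. periodic_point \<phi> a)" and \<epsilon>: "0 < \<epsilon>" "\<epsilon> < 1 / 2"
  shows "densely_eps_chaotic \<epsilon> (\<Gamma> \<rightarrow>\<^sub>E X) (shift_metric \<Gamma> \<beta>) (gen_shift \<Gamma> \<phi>)"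
  unfolding densely_eps_chaotic_def
    dense_in_square_iff[OF \<beta> subset_trans[OF eps_scrambled_pairs_subset scrambled_pairs_subset]]
proof (intro ballI allI impI)
  fix x y F
  assume xy: "x \<in> \<Gamma> \<rightarrow>\<^sub>E X" "y \<in> \<Gamma> \<rightarrow>\<^sub>E X" and F: "F \<subseteq> \<Gamma>" "finite F"
  let ?f = "gen_shift \<Gamma> \<phi>"
  obtain u v where uv: "u \<in> X" "v \<in> X" "u \<noteq> v"
    using two_elements[OF X] .
  have \<beta>_mem: "\<beta> k \<in> \<Gamma>" if "k \<in> enum_indices \<Gamma>" for k
    using \<beta> that by (auto simp: enumeration_of_def bij_betw_def)
  have one: "1 \<in> enum_indices \<Gamma>"
    using \<Gamma> by (auto simp: enum_indices_def Suc_le_eq card_gt_0_iff)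
  obtain D E where DE: "D \<inter> E = {}" "D \<inter> F = {}" "E \<inter> F = {}"
    and D: "\<And>j. \<exists>n\<ge>j. (\<phi> ^^ n) (\<beta> 1) \<in> D"
    and E: "\<And>j. \<exists>n\<ge>j. \<forall>k\<in>enum_indices \<Gamma> \<inter> {..j}. (\<phi> ^^ n) (\<beta> k) \<in> E"
    using disjoint_orbit_targets[of "enum_indices \<Gamma>" "\<lambda>k n. (\<phi> ^^ n) (\<beta> k)" 1 F]
      inj_orbit[OF \<phi> no_per \<beta>_mem] one F(2) by blast
  define x' where "x' = (\<lambda>i\<in>\<Gamma>. if i \<in> F then x i else u)"
  define y' where "y' = (\<lambda>i\<in>\<Gamma>. if i \<in> F then y i else if i \<in> D then v else u)"
  have Z: "x' \<in> \<Gamma> \<rightarrow>\<^sub>E X" "y' \<in> \<Gamma> \<rightarrow>\<^sub>E X"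
    using xy uv by (auto simp: x'_def y'_def)
  have D_neq: "x' i \<noteq> y' i" if "i \<in> D" "i \<in> \<Gamma>" for i
    using that DE uv by (auto simp: x'_def y'_def)
  have E_eq: "x' i = y' i" if "i \<in> E" for i
    using that DE by (auto simp: x'_def y'_def restrict_def)
  let ?d = "\<lambda>n. shift_metric \<Gamma> \<beta> ((?f ^^ n) x') ((?f ^^ n) y')"
  have "0 \<le> ?d n" for n
    by (rule Metric_space.nonneg[OF Metric_space_shift_metric[OF \<beta>]])
  moreover have "\<exists>n\<ge>j. ?d n \<le> 1 / 2 ^ j" for j
  proof -
    obtain n where n: "n \<ge> j" "\<forall>k\<in>enum_indices \<Gamma> \<inter> {..j}. (\<phi> ^^ n) (\<beta> k) \<in> E"
      using E by blast
    have "?d n \<le> 1 / 2 ^ j"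
      using n(2) by (intro shift_metric_tail) (simp add: gen_shift_funpow[OF \<phi> \<beta>_mem] E_eq)
    with n(1) show ?thesis
      by blast
  qed
  ultimately have liminf: "liminf (\<lambda>n. ereal (?d n)) = 0"
    by (rule liminf_eq_0I)
  have "\<exists>n\<ge>j. 1 / 2 \<le> ?d n" for j
  proof -
    obtain n where n: "n \<ge> j" "(\<phi> ^^ n) (\<beta> 1) \<in> D"
      using D by blast
    have "(?f ^^ n) x' (\<beta> 1) \<noteq> (?f ^^ n) y' (\<beta> 1)"
      using D_neq[OF n(2)] funpow_mem[OF \<phi> \<beta>_mem[OF one]]
      unfolding gen_shift_funpow[OF \<phi> \<beta>_mem[OF one]] by blast
    then have "1 / 2 ^ 1 \<le> ?d n"
      by (rule shift_metric_ge[OF one])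
    with n(1) show ?thesis
      by auto
  qed
  then have limsup: "ereal \<epsilon> < limsup (\<lambda>n. ereal (?d n))"
    using \<epsilon>(2) by (rule less_limsupI)
  moreover have "0 < ereal \<epsilon>"
    using \<epsilon>(1) by simp
  ultimately have "0 < limsup (\<lambda>n. ereal (?d n))"
    by (rule less_trans[rotated])
  with Z liminf limsup
  have "(x', y') \<in> eps_scrambled_pairs \<epsilon> (\<Gamma> \<rightarrow>\<^sub>E X) (shift_metric \<Gamma> \<beta>) ?f"
    by (simp add: eps_scrambled_pairs_def scrambled_pairs_def)
  moreover have "\<forall>i\<in>F. x' i = x i \<and> y' i = y i"
    using F(1) by (auto simp: x'_def y'_def)
  ultimately show "\<exists>(x', y')\<in>eps_scrambled_pairs \<epsilon> (\<Gamma> \<rightarrow>\<^sub>E X) (shift_metric \<Gamma> \<beta>) ?f.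
      \<forall>i\<in>F. x' i = x i \<and> y' i = y i"
    by blast
qed

section \<open>The equivalence\<close>

theorem theorem3p6:
  fixes X :: "'x set" and \<Gamma> :: "'g set" and \<phi> :: "'g \<Rightarrow> 'g" and \<beta> :: "nat \<Rightarrow> 'g"
  assumes "finite X" and "card X \<ge> 2"
    and "\<Gamma> \<noteq> {}" and "countable \<Gamma>"
    and "\<phi> \<in> \<Gamma> \<rightarrow> \<Gamma>"
    and "enumeration_of \<Gamma> \<beta>"
  shows "((\<exists>\<epsilon>>0. densely_eps_chaotic \<epsilon> (\<Gamma> \<rightarrow>\<^sub>E X) (shift_metric \<Gamma> \<beta>) (gen_shift \<Gamma> \<phi>)) \<longleftrightarrow>
          densely_chaotic (\<Gamma> \<rightarrow>\<^sub>E X) (shift_metric \<Gamma> \<beta>) (gen_shift \<Gamma> \<phi>)) \<and>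
         (densely_chaotic (\<Gamma> \<rightarrow>\<^sub>E X) (shift_metric \<Gamma> \<beta>) (gen_shift \<Gamma> \<phi>) \<longleftrightarrow>
          \<not> (\<exists>a\<in>\<Gamma>. periodic_point \<phi> a)) \<and>
         (\<not> (\<exists>a\<in>\<Gamma>. periodic_point \<phi> a) \<longleftrightarrow> non_quasi_periodic_points \<Gamma> \<phi> = \<Gamma>)"
    (is "(?eps \<longleftrightarrow> ?dense) \<and> (?dense \<longleftrightarrow> ?noper) \<and> (?noper \<longleftrightarrow> ?W)")
proof -
  have "?eps \<Longrightarrow> ?dense"
    using densely_eps_chaotic_imp_densely_chaotic Metric_space_shift_metric[OF assms(6)] by blast
  moreover have "?dense \<Longrightarrow> ?noper"
    by (rule densely_chaotic_imp_no_periodic[OF assms(2,5,6)])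
  moreover have "?noper \<Longrightarrow> ?eps"
    using no_periodic_imp_densely_eps_chaotic[OF assms(2,3,5,6), of "1 / 4"]
    by (intro exI[of _ "1 / 4"]) simp
  moreover have "?noper \<longleftrightarrow> ?W"
    by (rule no_periodic_iff_non_quasi_periodic[OF assms(5)])
  ultimately show ?thesis
    by blast
qed

end
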